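(* Let $f\in\mathbb Q_p[x]$ be an integer-valued, compatible and ergodic polynomial with $\deg f>1$. Let $x_0\in\mathbb Z_p$ and define $x_{n+1}=f(x_n)$ for $n\ge0$. Suppose there is $r\in\mathbb N$ such that for each $k\in\mathbb N$ there exist $c^{(k)},c^{(k)}_0,\dots,c^{(k)}_r\in\mathbb Z_p$ with $c^{(k)}+\sum_{i=0}^{r}c^{(k)}_ix_{n+i}\equiv 0\pmod{p^k}$ for all $n=0,1,2,\dots$. Then $\lim_{k\to\infty}c^{(k)}=\lim_{k\to\infty}c^{(k)}_0=\dots=\lim_{k\to\infty}c^{(k)}_r=0$, the limits taken in the $p$-adic norm.
   Context: $\mathbb Q_p$, $\mathbb Z_p$, $\|\cdot\|_p$ are the $p$-adic numbers, integers and norm; $a\equiv b\pmod{p^k}$ means $\|a-b\|_p\le p^{-k}$. A polynomial $f\in\mathbb Q_p[x]$ is integer-valued if $f(\mathbb Z_p)\subseteq\mathbb Z_p$, compatible if $\|f(x)-f(y)\|_p\le\|x-y\|_p$ for all $x,y\in\mathbb Z_p$, and (for compatible $f$) ergodic with respect to the normalized Haar measure, which is equivalent to $f$ inducing a single-cycle permutation of $\mathbb Z/p^k$ for every $k\ge1$. *)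

theory Defs
  imports "HOL-Analysis.Analysis" "Berlekamp_Zassenhaus.Finite_Field"
begin

subsection \<open>The \<open>p\<close>-adic norm on the rationals\<close>

definition rat_padic_norm :: "nat \<Rightarrow> rat \<Rightarrow> real" where
  "rat_padic_norm p x =
     (if x = 0 then 0
      else real p powi (int (multiplicity (int p) (snd (quotient_of x)))
                        - int (multiplicity (int p) (fst (quotient_of x)))))"

lemma rat_padic_norm_0 [simp]: "rat_padic_norm p 0 = 0"
  by (simp add: rat_padic_norm_def)

context
  fixes p :: nat
  assumes p: "prime p"
begin

lemma rat_padic_norm_frac:
  assumes "a \<noteq> 0" "b \<noteq> 0"
  shows "rat_padic_norm p (of_int a / of_int b) =
    real p powi (int (multiplicity (int p) b) - int (multiplicity (int p) a))"
proof -
  define x :: rat where "x = of_int a / of_int b"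
  obtain n d where nd: "quotient_of x = (n, d)" by fastforce
  have d: "d > 0" and x: "x = of_int n / of_int d"
    using quotient_of_denom_pos[OF nd] quotient_of_div[OF nd] by auto
  have x0: "x \<noteq> 0" using assms by (simp add: x_def)
  hence n: "n \<noteq> 0" using x by auto
  have "(of_int (a * d) :: rat) = of_int (n * b)"
    using x d assms by (simp add: x_def field_simps)
  hence eq: "a * d = n * b" by (simp only: of_int_eq_iff)
  have pe: "prime_elem (int p)" using p by auto
  have "multiplicity (int p) a + multiplicity (int p) d
      = multiplicity (int p) n + multiplicity (int p) b"
    using prime_elem_multiplicity_mult_distrib[OF pe, of a d]
      prime_elem_multiplicity_mult_distrib[OF pe, of n b] eq assms n d by simp
  hence "int (multiplicity (int p) d) - int (multiplicity (int p) n)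
       = int (multiplicity (int p) b) - int (multiplicity (int p) a)" by linarith
  thus ?thesis using x0 nd by (simp add: rat_padic_norm_def x_def)
qed

lemma rat_frac_cases:
  fixes x :: rat
  assumes "x \<noteq> 0"
  obtains a b where "a \<noteq> 0" "b \<noteq> 0" "x = of_int a / of_int b"
proof -
  obtain n d where nd: "quotient_of x = (n, d)" by fastforce
  have "d > 0" "x = of_int n / of_int d"
    using quotient_of_denom_pos[OF nd] quotient_of_div[OF nd] by auto
  thus ?thesis using assms by (intro that[of n d]) auto
qed

lemma rat_padic_norm_pos: "x \<noteq> 0 \<Longrightarrow> rat_padic_norm p x > 0"
  using p by (simp add: rat_padic_norm_def prime_gt_0_nat)

lemma rat_padic_norm_nonneg [simp]: "rat_padic_norm p x \<ge> 0"
  using rat_padic_norm_pos[of x] by (cases "x = 0") auto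

lemma rat_padic_norm_eq_0_iff [simp]: "rat_padic_norm p x = 0 \<longleftrightarrow> x = 0"
  using rat_padic_norm_pos[of x] by (cases "x = 0") auto

lemma rat_padic_norm_1 [simp]: "rat_padic_norm p 1 = 1"
  by (simp add: rat_padic_norm_def)

lemma rat_padic_norm_mult:
  "rat_padic_norm p (x * y) = rat_padic_norm p x * rat_padic_norm p y"
proof (cases "x = 0 \<or> y = 0")
  case False
  obtain a b where ab: "a \<noteq> 0" "b \<noteq> 0" "x = of_int a / of_int b"
    using rat_frac_cases False by metis
  obtain c d where cd: "c \<noteq> 0" "d \<noteq> 0" "y = of_int c / of_int d"
    using rat_frac_cases False by metis
  have xy: "x * y = of_int (a * c) / of_int (b * d)" using ab cd by simp
  have pe: "prime_elem (int p)" using p by auto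
  have p0: "real p \<noteq> 0" using p by auto
  show ?thesis
    unfolding xy unfolding ab(3) cd(3)
    using ab cd p0
    by (simp add: rat_padic_norm_frac prime_elem_multiplicity_mult_distrib[OF pe]
        power_int_add[symmetric] algebra_simps del: of_int_mult)
qed auto

lemma rat_padic_norm_minus [simp]: "rat_padic_norm p (- x) = rat_padic_norm p x"
proof -
  have "rat_padic_norm p (-1) * rat_padic_norm p (-1) = 1"
    using rat_padic_norm_mult[of "-1" "-1"] by simp
  hence "rat_padic_norm p (-1) = 1"
    using rat_padic_norm_nonneg[of "-1"] by (metis power2_eq_1_iff power2_eq_square neg_0_le_iff_le not_one_le_zero)
  thus ?thesis using rat_padic_norm_mult[of "-1" x] by simp
qed

lemma rat_padic_norm_diff_commute: "rat_padic_norm p (x - y) = rat_padic_norm p (y - x)"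
  using rat_padic_norm_minus[of "x - y"] by simp

lemma rat_padic_norm_inverse: "rat_padic_norm p (inverse x) = inverse (rat_padic_norm p x)"
proof (cases "x = 0")
  case False
  thus ?thesis using rat_padic_norm_mult[of x "inverse x"]
    by (simp add: field_simps)
qed auto

lemma rat_padic_norm_ultrametric:
  "rat_padic_norm p (x + y) \<le> max (rat_padic_norm p x) (rat_padic_norm p y)"
proof (cases "x = 0 \<or> y = 0 \<or> x + y = 0")
  case False
  obtain a b where ab: "a \<noteq> 0" "b \<noteq> 0" "x = of_int a / of_int b"
    using rat_frac_cases False by metis
  obtain c d where cd: "c \<noteq> 0" "d \<noteq> 0" "y = of_int c / of_int d"
    using rat_frac_cases False by metis
  define A C D where "A = a * d" and "C = c * b" and "D = b * d"
  have D: "D \<noteq> 0" and A: "A \<noteq> 0" and C: "C \<noteq> 0" using ab cd by (auto simp: A_def C_def D_def)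
  have x: "x = of_int A / of_int D" and y: "y = of_int C / of_int D"
    using ab cd by (auto simp: A_def C_def D_def)
  have xy: "x + y = of_int (A + C) / of_int D"
    by (simp add: x y add_divide_distrib)
  have AC: "A + C \<noteq> 0" using xy False by force
  define m where "m = min (multiplicity (int p) A) (multiplicity (int p) C)"
  have "int p ^ m dvd A" "int p ^ m dvd C"
    by (auto simp: m_def intro: multiplicity_dvd')
  hence "int p ^ m dvd A + C" by simp
  moreover have "\<not> is_unit (int p)" using p by (auto simp: prime_nat_iff)
  ultimately have "m \<le> multiplicity (int p) (A + C)"
    using AC by (intro multiplicity_geI) auto
  moreover have "real p \<ge> 1"
    using prime_ge_1_nat[OF p] by simp
  ultimately have le: "rat_padic_norm p (x + y) \<le> real p powi (int (multiplicity (int p) D) - int m)"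
    unfolding xy rat_padic_norm_frac[OF AC D] by (intro power_int_increasing) auto
  have "m = multiplicity (int p) A \<or> m = multiplicity (int p) C"
    by (auto simp: m_def)
  thus ?thesis
  proof
    assume "m = multiplicity (int p) A"
    hence "real p powi (int (multiplicity (int p) D) - int m) = rat_padic_norm p x"
      unfolding x rat_padic_norm_frac[OF A D] by simp
    with le show ?thesis by linarith
  next
    assume "m = multiplicity (int p) C"
    hence "real p powi (int (multiplicity (int p) D) - int m) = rat_padic_norm p y"
      unfolding y rat_padic_norm_frac[OF C D] by simp
    with le show ?thesis by linarith
  qed
qed (auto simp: add_eq_0_iff le_max_iff_disj)

lemma rat_padic_norm_triangle:
  "rat_padic_norm p (x + y) \<le> rat_padic_norm p x + rat_padic_norm p y"
  using rat_padic_norm_ultrametric[of x y] rat_padic_norm_nonneg[of x] rat_padic_norm_nonneg[of y]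
  by linarith

lemma rat_padic_norm_abs_diff:
  "\<bar>rat_padic_norm p x - rat_padic_norm p y\<bar> \<le> rat_padic_norm p (x - y)"
  using rat_padic_norm_triangle[of "x - y" y] rat_padic_norm_triangle[of "y - x" x]
    rat_padic_norm_diff_commute[of x y] by auto

end


subsection \<open>Cauchy sequences of rationals\<close>

definition padic_cauchy :: "nat \<Rightarrow> (nat \<Rightarrow> rat) \<Rightarrow> bool" where
  "padic_cauchy p X \<longleftrightarrow> (\<forall>e>0. \<exists>N. \<forall>m\<ge>N. \<forall>n\<ge>N. rat_padic_norm p (X m - X n) < e)"

lemma padic_cauchy_const [simp]: "padic_cauchy p (\<lambda>_. c)"
  by (auto simp: padic_cauchy_def)

context
  fixes p :: nat
  assumes p: "prime p"
begin

lemma padic_cauchy_add: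
  assumes "padic_cauchy p X" "padic_cauchy p Y"
  shows "padic_cauchy p (\<lambda>n. X n + Y n)"
  unfolding padic_cauchy_def
proof (intro allI impI)
  fix e :: real assume e: "e > 0"
  obtain N where N: "\<forall>m\<ge>N. \<forall>n\<ge>N. rat_padic_norm p (X m - X n) < e"
    using assms(1) e by (auto simp: padic_cauchy_def)
  obtain M where M: "\<forall>m\<ge>M. \<forall>n\<ge>M. rat_padic_norm p (Y m - Y n) < e"
    using assms(2) e by (auto simp: padic_cauchy_def)
  show "\<exists>N. \<forall>m\<ge>N. \<forall>n\<ge>N. rat_padic_norm p (X m + Y m - (X n + Y n)) < e"
  proof (intro exI[of _ "max N M"] allI impI)
    fix m n assume "m \<ge> max N M" "n \<ge> max N M"
    hence "rat_padic_norm p (X m - X n) < e" "rat_padic_norm p (Y m - Y n) < e"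
      using N M by auto
    thus "rat_padic_norm p (X m + Y m - (X n + Y n)) < e"
      using rat_padic_norm_ultrametric[OF p, of "X m - X n" "Y m - Y n"]
      by (simp add: algebra_simps)
  qed
qed

lemma padic_cauchy_minus:
  assumes "padic_cauchy p X"
  shows "padic_cauchy p (\<lambda>n. - X n)"
proof -
  have "rat_padic_norm p (- X m - - X n) = rat_padic_norm p (X m - X n)" for m n
    using rat_padic_norm_minus[OF p, of "X m - X n"] by (simp add: algebra_simps)
  thus ?thesis using assms by (simp add: padic_cauchy_def)
qed

lemma padic_cauchy_convergent_norm:
  assumes "padic_cauchy p X"
  shows "convergent (\<lambda>n. rat_padic_norm p (X n))"
  unfolding Cauchy_convergent_iff[symmetric] Cauchy_iff
proof (intro allI impI)
  fix e :: real assume "e > 0"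
  then obtain N where "\<forall>m\<ge>N. \<forall>n\<ge>N. rat_padic_norm p (X m - X n) < e"
    using assms by (auto simp: padic_cauchy_def)
  thus "\<exists>M. \<forall>m\<ge>M. \<forall>n\<ge>M. norm (rat_padic_norm p (X m) - rat_padic_norm p (X n)) < e"
    using rat_padic_norm_abs_diff[OF p] unfolding real_norm_def by (meson order.strict_trans1)
qed

lemma padic_cauchy_bounded:
  assumes "padic_cauchy p X"
  obtains B where "B > 0" "\<And>n. rat_padic_norm p (X n) \<le> B"
proof -
  have "Bseq (\<lambda>n. rat_padic_norm p (X n))"
    using padic_cauchy_convergent_norm[OF assms] by (rule convergent_imp_Bseq)
  thus ?thesis using that rat_padic_norm_nonneg[OF p] by (auto simp: Bseq_def)
qed

lemma padic_cauchy_mult: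
  assumes X: "padic_cauchy p X" and Y: "padic_cauchy p Y"
  shows "padic_cauchy p (\<lambda>n. X n * Y n)"
  unfolding padic_cauchy_def
proof (intro allI impI)
  fix e :: real assume e: "e > 0"
  obtain A where A: "A > 0" "\<And>n. rat_padic_norm p (X n) \<le> A"
    using padic_cauchy_bounded[OF X] by auto
  obtain B where B: "B > 0" "\<And>n. rat_padic_norm p (Y n) \<le> B"
    using padic_cauchy_bounded[OF Y] by auto
  have "e / B > 0" "e / A > 0" using e A B by auto
  obtain N where N: "\<forall>m\<ge>N. \<forall>n\<ge>N. rat_padic_norm p (X m - X n) < e / B"
    using X \<open>e / B > 0\<close> unfolding padic_cauchy_def by blast
  obtain M where M: "\<forall>m\<ge>M. \<forall>n\<ge>M. rat_padic_norm p (Y m - Y n) < e / A"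
    using Y \<open>e / A > 0\<close> unfolding padic_cauchy_def by blast
  show "\<exists>N. \<forall>m\<ge>N. \<forall>n\<ge>N. rat_padic_norm p (X m * Y m - X n * Y n) < e"
  proof (intro exI[of _ "max N M"] allI impI)
    fix m n assume mn: "m \<ge> max N M" "n \<ge> max N M"
    have "rat_padic_norm p (X m * (Y m - Y n)) \<le> A * rat_padic_norm p (Y m - Y n)"
      using A by (auto simp: rat_padic_norm_mult[OF p] rat_padic_norm_nonneg[OF p] intro!: mult_right_mono)
    also have "\<dots> < A * (e / A)" using A mn M by (intro mult_strict_left_mono) auto
    finally have 1: "rat_padic_norm p (X m * (Y m - Y n)) < e" using A by simp
    have "rat_padic_norm p ((X m - X n) * Y n) \<le> rat_padic_norm p (X m - X n) * B"
      using B by (auto simp: rat_padic_norm_mult[OF p] rat_padic_norm_nonneg[OF p] intro!: mult_left_mono)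
    also have "\<dots> < e / B * B" using B mn N by (intro mult_strict_right_mono) auto
    finally have 2: "rat_padic_norm p ((X m - X n) * Y n) < e" using B by simp
    have "X m * Y m - X n * Y n = X m * (Y m - Y n) + (X m - X n) * Y n"
      by (simp add: algebra_simps)
    thus "rat_padic_norm p (X m * Y m - X n * Y n) < e"
      using 1 2 rat_padic_norm_ultrametric[OF p, of "X m * (Y m - Y n)" "(X m - X n) * Y n"]
      by simp
  qed
qed

lemma padic_cauchy_inverse:
  assumes X: "padic_cauchy p X" and nz: "\<not> (\<lambda>n. rat_padic_norm p (X n)) \<longlonglongrightarrow> 0"
  shows "padic_cauchy p (\<lambda>n. inverse (X n))" "\<forall>\<^sub>F n in sequentially. X n \<noteq> 0"
proof -
  obtain L where L: "(\<lambda>n. rat_padic_norm p (X n)) \<longlonglongrightarrow> L"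
    using padic_cauchy_convergent_norm[OF X] by (auto simp: convergent_def)
  have "L \<ge> 0" using L by (rule LIMSEQ_le_const) (auto simp: rat_padic_norm_nonneg[OF p])
  hence L0: "L > 0" using L nz by (cases "L = 0") auto
  hence ev: "\<forall>\<^sub>F n in sequentially. rat_padic_norm p (X n) > L / 2"
    using L by (intro order_tendstoD(1)[OF L]) auto
  thus "\<forall>\<^sub>F n in sequentially. X n \<noteq> 0"
    by eventually_elim (use L0 in auto)
  from ev obtain M where M: "\<And>n. n \<ge> M \<Longrightarrow> rat_padic_norm p (X n) > L / 2"
    by (auto simp: eventually_sequentially)
  show "padic_cauchy p (\<lambda>n. inverse (X n))"
    unfolding padic_cauchy_def
  proof (intro allI impI)
    fix e :: real assume "e > 0"
    hence "e * (L/2 * (L/2)) > 0" using L0 by auto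
    then obtain N where N: "\<forall>m\<ge>N. \<forall>n\<ge>N. rat_padic_norm p (X m - X n) < e * (L/2 * (L/2))"
      using X unfolding padic_cauchy_def by blast
    show "\<exists>N. \<forall>m\<ge>N. \<forall>n\<ge>N. rat_padic_norm p (inverse (X m) - inverse (X n)) < e"
    proof (intro exI[of _ "max N M"] allI impI)
      fix m n assume mn: "m \<ge> max N M" "n \<ge> max N M"
      have m: "rat_padic_norm p (X m) > L/2" and n: "rat_padic_norm p (X n) > L/2"
        using M mn by auto
      have nz: "X m \<noteq> 0" "X n \<noteq> 0" using m n L0 by auto
      have pos: "rat_padic_norm p (X m) * rat_padic_norm p (X n) > 0"
        using nz by (simp add: rat_padic_norm_pos[OF p])
      have "X n - X m = (inverse (X m) - inverse (X n)) * (X m * X n)"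
        using nz by (simp add: field_simps)
      hence eq: "rat_padic_norm p (X n - X m) = rat_padic_norm p (inverse (X m) - inverse (X n)) *
          (rat_padic_norm p (X m) * rat_padic_norm p (X n))"
        by (simp add: rat_padic_norm_mult[OF p])
      have "rat_padic_norm p (X n - X m) < e * (L/2 * (L/2))" using N mn by auto
      also have "\<dots> \<le> e * (rat_padic_norm p (X m) * rat_padic_norm p (X n))"
        using m n \<open>e > 0\<close> L0 by (intro mult_left_mono mult_mono) auto
      finally show "rat_padic_norm p (inverse (X m) - inverse (X n)) < e"
        using pos mult_less_cancel_right_pos[OF pos] unfolding eq by blast
    qed
  qed
qed

end

text \<open>The prime \<open>p\<close> is the cardinality of the type parameter \<open>'p\<close>.\<close>

typedef (overloaded) ('p::prime_card) padic_cauchy_seq = "{X. padic_cauchy CARD('p) X}"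
  by (rule exI[of _ "\<lambda>_. 0"]) auto

setup_lifting type_definition_padic_cauchy_seq

instantiation padic_cauchy_seq :: (prime_card) comm_ring_1
begin

lift_definition zero_padic_cauchy_seq :: "'a padic_cauchy_seq" is "\<lambda>_. 0" by simp
lift_definition one_padic_cauchy_seq :: "'a padic_cauchy_seq" is "\<lambda>_. 1" by simp
lift_definition plus_padic_cauchy_seq ::
  "'a padic_cauchy_seq \<Rightarrow> 'a padic_cauchy_seq \<Rightarrow> 'a padic_cauchy_seq"
  is "\<lambda>X Y n. X n + Y n" by (rule padic_cauchy_add[OF prime_card])
lift_definition uminus_padic_cauchy_seq :: "'a padic_cauchy_seq \<Rightarrow> 'a padic_cauchy_seq"
  is "\<lambda>X n. - X n" by (rule padic_cauchy_minus[OF prime_card])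
lift_definition times_padic_cauchy_seq ::
  "'a padic_cauchy_seq \<Rightarrow> 'a padic_cauchy_seq \<Rightarrow> 'a padic_cauchy_seq"
  is "\<lambda>X Y n. X n * Y n" by (rule padic_cauchy_mult[OF prime_card])
definition "X - Y = X + - Y" for X Y :: "'a padic_cauchy_seq"

instance
proof
  fix X Y Z :: "'a padic_cauchy_seq"
  show "X + Y + Z = X + (Y + Z)" by transfer (simp add: algebra_simps)
  show "X + Y = Y + X" by transfer (simp add: algebra_simps)
  show "0 + X = X" by transfer simp
  show "- X + X = 0" by transfer simp
  show "X - Y = X + - Y" by (rule minus_padic_cauchy_seq_def)
  show "X * Y * Z = X * (Y * Z)" by transfer (simp add: algebra_simps)
  show "X * Y = Y * X" by transfer (simp add: algebra_simps)
  show "1 * X = X" by transfer simp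
  show "(X + Y) * Z = X * Z + Y * Z" by transfer (simp add: algebra_simps)
  show "(0 :: 'a padic_cauchy_seq) \<noteq> 1" by transfer (simp add: fun_eq_iff)
qed

end

lemma minus_padic_cauchy_seq_rep_eq:
  "Rep_padic_cauchy_seq (X - Y) = (\<lambda>n. Rep_padic_cauchy_seq X n - Rep_padic_cauchy_seq Y n)"
  unfolding minus_padic_cauchy_seq_def plus_padic_cauchy_seq.rep_eq uminus_padic_cauchy_seq.rep_eq
  by simp

lift_definition cauchy_seq_norm :: "'p::prime_card padic_cauchy_seq \<Rightarrow> real"
  is "\<lambda>X. lim (\<lambda>n. rat_padic_norm CARD('p) (X n))" .

lemma cauchy_seq_norm_tendsto:
  "(\<lambda>n. rat_padic_norm CARD('p) (Rep_padic_cauchy_seq X n)) \<longlonglongrightarrow> cauchy_seq_norm X"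
  for X :: "'p::prime_card padic_cauchy_seq"
  by transfer (simp add: padic_cauchy_convergent_norm[OF prime_card] convergent_LIMSEQ_iff[symmetric])

lemma cauchy_seq_norm_nonneg: "cauchy_seq_norm X \<ge> 0"
  by (rule LIMSEQ_le_const[OF cauchy_seq_norm_tendsto])
     (auto simp: rat_padic_norm_nonneg[OF prime_card])

lemma cauchy_seq_norm_0 [simp]: "cauchy_seq_norm 0 = 0"
  by transfer (simp add: lim_const)

lemma cauchy_seq_norm_1 [simp]: "cauchy_seq_norm 1 = 1"
  by transfer (simp add: rat_padic_norm_1[OF prime_card] lim_const)

lemma cauchy_seq_norm_minus [simp]: "cauchy_seq_norm (- X) = cauchy_seq_norm X"
  by transfer (simp add: rat_padic_norm_minus[OF prime_card])

lemma cauchy_seq_norm_mult: "cauchy_seq_norm (X * Y) = cauchy_seq_norm X * cauchy_seq_norm Y"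
proof (rule LIMSEQ_unique[OF cauchy_seq_norm_tendsto])
  show "(\<lambda>n. rat_padic_norm CARD('a) (Rep_padic_cauchy_seq (X * Y) n))
          \<longlonglongrightarrow> cauchy_seq_norm X * cauchy_seq_norm Y"
    using tendsto_mult[OF cauchy_seq_norm_tendsto[of X] cauchy_seq_norm_tendsto[of Y]]
    by (simp add: times_padic_cauchy_seq.rep_eq rat_padic_norm_mult[OF prime_card])
qed

lemma cauchy_seq_norm_ultrametric:
  "cauchy_seq_norm (X + Y) \<le> max (cauchy_seq_norm X) (cauchy_seq_norm Y)"
proof (rule LIMSEQ_le[OF cauchy_seq_norm_tendsto
      tendsto_max[OF cauchy_seq_norm_tendsto[of X] cauchy_seq_norm_tendsto[of Y]]])
  show "\<exists>N. \<forall>n\<ge>N. rat_padic_norm CARD('a) (Rep_padic_cauchy_seq (X + Y) n)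
      \<le> max (rat_padic_norm CARD('a) (Rep_padic_cauchy_seq X n))
            (rat_padic_norm CARD('a) (Rep_padic_cauchy_seq Y n))"
    by (simp add: plus_padic_cauchy_seq.rep_eq rat_padic_norm_ultrametric[OF prime_card])
qed

lemma cauchy_seq_norm_diff_0_trans:
  assumes "cauchy_seq_norm (X - Y) = 0" "cauchy_seq_norm (Y - Z) = 0"
  shows "cauchy_seq_norm (X - Z) = 0"
  using cauchy_seq_norm_ultrametric[of "X - Y" "Y - Z"] cauchy_seq_norm_nonneg[of "X - Z"] assms
  by simp

lemma cauchy_seq_norm_diff_commute: "cauchy_seq_norm (X - Y) = cauchy_seq_norm (Y - X)"
  using cauchy_seq_norm_minus[of "X - Y"] by simp

lemma cauchy_seq_norm_cong:
  assumes "cauchy_seq_norm (X - Y) = 0"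
  shows "cauchy_seq_norm X = cauchy_seq_norm Y"
  using cauchy_seq_norm_ultrametric[of "X - Y" Y] cauchy_seq_norm_ultrametric[of "Y - X" X]
    cauchy_seq_norm_diff_commute[of X Y] cauchy_seq_norm_nonneg[of X] cauchy_seq_norm_nonneg[of Y]
    assms by simp

lemma cauchy_seq_inverse_exists:
  assumes "cauchy_seq_norm X \<noteq> 0"
  shows "\<exists>Y. cauchy_seq_norm (X * Y - 1) = 0"
proof -
  define x where "x = Rep_padic_cauchy_seq X"
  have x: "padic_cauchy CARD('a) x" using Rep_padic_cauchy_seq[of X] by (simp add: x_def)
  have "\<not> (\<lambda>n. rat_padic_norm CARD('a) (x n)) \<longlonglongrightarrow> 0"
    using cauchy_seq_norm_tendsto[of X] assms LIMSEQ_unique unfolding x_def by blast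
  note inv = padic_cauchy_inverse[OF prime_card x this]
  define Y :: "'a padic_cauchy_seq" where "Y = Abs_padic_cauchy_seq (\<lambda>n. inverse (x n))"
  have Y: "Rep_padic_cauchy_seq Y = (\<lambda>n. inverse (x n))"
    unfolding Y_def using inv(1) by (simp add: Abs_padic_cauchy_seq_inverse)
  have "\<forall>\<^sub>F n in sequentially. rat_padic_norm CARD('a) (Rep_padic_cauchy_seq (X * Y - 1) n) = 0"
    using inv(2)
    by eventually_elim (simp add: minus_padic_cauchy_seq_rep_eq times_padic_cauchy_seq.rep_eq one_padic_cauchy_seq.rep_eq
        Y flip: x_def)
  hence "(\<lambda>n. rat_padic_norm CARD('a) (Rep_padic_cauchy_seq (X * Y - 1) n)) \<longlonglongrightarrow> 0"
    by (rule tendsto_eventually)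
  thus ?thesis using LIMSEQ_unique[OF cauchy_seq_norm_tendsto] by blast
qed


subsection \<open>The field of \<open>p\<close>-adic numbers\<close>

definition padic_rel :: "'p::prime_card padic_cauchy_seq \<Rightarrow> 'p padic_cauchy_seq \<Rightarrow> bool" where
  "padic_rel X Y \<longleftrightarrow> cauchy_seq_norm (X - Y) = 0"

quotient_type (overloaded) 'p padic = "'p::prime_card padic_cauchy_seq" / padic_rel
proof (rule equivpI)
  show "reflp (padic_rel :: 'p padic_cauchy_seq \<Rightarrow> _)" by (auto simp: reflp_def padic_rel_def)
  show "symp (padic_rel :: 'p padic_cauchy_seq \<Rightarrow> _)"
    by (auto simp: symp_def padic_rel_def cauchy_seq_norm_diff_commute)
  show "transp (padic_rel :: 'p padic_cauchy_seq \<Rightarrow> _)"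
    unfolding transp_def padic_rel_def using cauchy_seq_norm_diff_0_trans by blast
qed

instantiation padic :: (prime_card) field
begin

lift_definition zero_padic :: "'a padic" is 0 .
lift_definition one_padic :: "'a padic" is 1 .
lift_definition plus_padic :: "'a padic \<Rightarrow> 'a padic \<Rightarrow> 'a padic" is "(+)"
proof -
  fix X X' Y Y' :: "'a padic_cauchy_seq"
  assume "padic_rel X X'" "padic_rel Y Y'"
  thus "padic_rel (X + Y) (X' + Y')"
    using cauchy_seq_norm_ultrametric[of "X - X'" "Y - Y'"]
      cauchy_seq_norm_nonneg[of "X + Y - (X' + Y')"]
    by (simp add: padic_rel_def algebra_simps)
qed
lift_definition uminus_padic :: "'a padic \<Rightarrow> 'a padic" is "uminus"
  by (simp add: padic_rel_def) (metis cauchy_seq_norm_diff_commute)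
lift_definition minus_padic :: "'a padic \<Rightarrow> 'a padic \<Rightarrow> 'a padic" is "(-)"
proof -
  fix X X' Y Y' :: "'a padic_cauchy_seq"
  assume "padic_rel X X'" "padic_rel Y Y'"
  thus "padic_rel (X - Y) (X' - Y')"
    using cauchy_seq_norm_ultrametric[of "X - X'" "Y' - Y"] cauchy_seq_norm_diff_commute[of Y Y']
      cauchy_seq_norm_nonneg[of "X - Y - (X' - Y')"]
    by (simp add: padic_rel_def algebra_simps)
qed
lift_definition times_padic :: "'a padic \<Rightarrow> 'a padic \<Rightarrow> 'a padic" is "(*)"
proof -
  fix X X' Y Y' :: "'a padic_cauchy_seq"
  assume *: "padic_rel X X'" "padic_rel Y Y'"
  have "X * Y - X' * Y' = (X - X') * Y + X' * (Y - Y')" by (simp add: algebra_simps)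
  thus "padic_rel (X * Y) (X' * Y')"
    using cauchy_seq_norm_ultrametric[of "(X - X') * Y" "X' * (Y - Y')"] *
      cauchy_seq_norm_nonneg[of "X * Y - X' * Y'"]
    by (simp add: padic_rel_def cauchy_seq_norm_mult)
qed
definition inverse_padic :: "'a padic \<Rightarrow> 'a padic" where
  "inverse_padic x = (if x = 0 then 0 else (THE y. x * y = 1))"
definition divide_padic :: "'a padic \<Rightarrow> 'a padic \<Rightarrow> 'a padic" where
  "divide_padic x y = x * inverse y"

instance
proof
  fix a b c :: "'a padic"
  have refl: "padic_rel X X" for X :: "'a padic_cauchy_seq" by (simp add: padic_rel_def)
  show "a + b + c = a + (b + c)" by transfer (simp add: refl algebra_simps)
  show "a + b = b + a" by transfer (simp add: refl algebra_simps)
  show "0 + a = a" by transfer (simp add: refl)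
  show "- a + a = 0" by transfer (simp add: refl)
  show "a - b = a + - b" by transfer (simp add: refl)
  show assoc: "a * b * c = a * (b * c)" for a b c :: "'a padic"
    by transfer (simp add: refl algebra_simps)
  show comm: "a * b = b * a" for a b :: "'a padic" by transfer (simp add: refl algebra_simps)
  show one: "1 * a = a" for a :: "'a padic" by transfer (simp add: refl)
  show "(a + b) * c = a * c + b * c" by transfer (simp add: refl algebra_simps)
  show "(0 :: 'a padic) \<noteq> 1" by transfer (simp add: padic_rel_def)
  show "a div b = a * inverse b" by (rule divide_padic_def)
  show "inverse (0 :: 'a padic) = 0" by (simp add: inverse_padic_def)
  show "inverse a * a = 1" if "a \<noteq> 0"
  proof -
    have "\<exists>y. a * y = 1" using that
      by transfer (use cauchy_seq_inverse_exists in \<open>auto simp: padic_rel_def\<close>)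
    then obtain y where y: "a * y = 1" by blast
    have "z = y" if "a * z = 1" for z
      using that y by (metis assoc comm one)
    hence "(THE y. a * y = 1) = y" using y by (intro the_equality)
    hence "inverse a = y" using \<open>a \<noteq> 0\<close> by (simp add: inverse_padic_def)
    thus ?thesis using y comm[of a y] by simp
  qed
qed

end

text \<open>
  The library constant \<open>norm\<close> is restricted to real normed vector spaces, hence a separate
  constant here. Limits in \<open>padic\<close> refer to the metric that it induces.
\<close>

lift_definition padic_norm :: "'p::prime_card padic \<Rightarrow> real" (\<open>(\<open>open_block notation=\<open>mixfix padic norm\<close>\<close>\<parallel>_\<parallel>\<^sub>p)\<close>)
  is cauchy_seq_norm
  by (auto simp: padic_rel_def cauchy_seq_norm_cong)

lemma padic_norm_nonneg [simp]: "\<parallel>x\<parallel>\<^sub>p \<ge> 0"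
  by transfer (rule cauchy_seq_norm_nonneg)

lemma padic_norm_eq_0_iff [simp]: "\<parallel>x\<parallel>\<^sub>p = 0 \<longleftrightarrow> x = 0"
  by transfer (simp add: padic_rel_def)

lemma padic_norm_1 [simp]: "\<parallel>1\<parallel>\<^sub>p = 1"
  by transfer simp

lemma padic_norm_minus [simp]: "\<parallel>- x\<parallel>\<^sub>p = \<parallel>x\<parallel>\<^sub>p"
  by transfer simp

lemma padic_norm_mult: "\<parallel>x * y\<parallel>\<^sub>p = \<parallel>x\<parallel>\<^sub>p * \<parallel>y\<parallel>\<^sub>p"
  by transfer (rule cauchy_seq_norm_mult)

lemma padic_norm_ultrametric: "\<parallel>x + y\<parallel>\<^sub>p \<le> max \<parallel>x\<parallel>\<^sub>p \<parallel>y\<parallel>\<^sub>p"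
  by transfer (rule cauchy_seq_norm_ultrametric)

lemma padic_norm_diff_commute: "\<parallel>x - y\<parallel>\<^sub>p = \<parallel>y - x\<parallel>\<^sub>p"
  using padic_norm_minus[of "x - y"] by simp

instantiation padic :: (prime_card) metric_space
begin

definition dist_padic :: "'a padic \<Rightarrow> 'a padic \<Rightarrow> real" where
  "dist_padic x y = \<parallel>x - y\<parallel>\<^sub>p"

definition uniformity_padic :: "('a padic \<times> 'a padic) filter" where
  "uniformity_padic = (INF e\<in>{0 <..}. principal {(x, y). dist x y < e})"

definition open_padic :: "'a padic set \<Rightarrow> bool" where
  "open_padic U \<longleftrightarrow> (\<forall>x\<in>U. eventually (\<lambda>(x', y). x' = x \<longrightarrow> y \<in> U) uniformity)"

instance
proof
  fix x y z :: "'a padic"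
  show "dist x y = 0 \<longleftrightarrow> x = y" by (simp add: dist_padic_def)
  have "\<parallel>x - y\<parallel>\<^sub>p \<le> max \<parallel>x - z\<parallel>\<^sub>p \<parallel>z - y\<parallel>\<^sub>p"
    using padic_norm_ultrametric[of "x - z" "z - y"] by simp
  thus "dist x y \<le> dist x z + dist y z"
    using padic_norm_nonneg[of "x - z"] padic_norm_nonneg[of "z - y"]
    unfolding dist_padic_def padic_norm_diff_commute[of y z] by linarith
qed (simp_all add: uniformity_padic_def open_padic_def)

end

text \<open>
  The following facts confirm that the type is the completion of \<open>\<rat>\<close>: it contains \<open>\<rat>\<close> isometrically
  and densely, and it is complete.
\<close>

lemma cauchy_seq_of_nat: "Rep_padic_cauchy_seq (of_nat k) = (\<lambda>_. of_nat k)"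
  by (induction k)
     (simp_all add: zero_padic_cauchy_seq.rep_eq one_padic_cauchy_seq.rep_eq
        plus_padic_cauchy_seq.rep_eq)

lemma abs_padic_of_nat: "abs_padic (of_nat k) = of_nat k"
  by (induction k) (simp_all add: zero_padic.abs_eq one_padic.abs_eq flip: plus_padic.abs_eq)

lemma padic_norm_abs: "\<parallel>abs_padic X\<parallel>\<^sub>p = cauchy_seq_norm X"
  by (rule padic_norm.abs_eq)

lemma padic_norm_of_nat: "\<parallel>of_nat k :: 'p::prime_card padic\<parallel>\<^sub>p = rat_padic_norm CARD('p) (of_nat k)"
proof -
  have "cauchy_seq_norm (of_nat k :: 'p padic_cauchy_seq) = rat_padic_norm CARD('p) (of_nat k)"
    using cauchy_seq_norm_tendsto[of "of_nat k :: 'p padic_cauchy_seq"]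
    by (simp add: cauchy_seq_of_nat LIMSEQ_const_iff)
  thus ?thesis by (simp add: padic_norm_abs flip: abs_padic_of_nat)
qed

instance padic :: (prime_card) field_char_0
proof
  show "inj (of_nat :: nat \<Rightarrow> 'a padic)"
  proof (rule linorder_injI)
    fix m n :: nat assume "m < n"
    hence "\<parallel>of_nat (n - m) :: 'a padic\<parallel>\<^sub>p \<noteq> 0"
      unfolding padic_norm_of_nat by (simp add: rat_padic_norm_eq_0_iff[OF prime_card])
    thus "(of_nat m :: 'a padic) \<noteq> of_nat n"
      using \<open>m < n\<close> by (auto simp: of_nat_diff)
  qed
qed

lemma abs_padic_of_int: "abs_padic (of_int k) = of_int k"
  by (cases k rule: int_diff_cases)
     (simp add: abs_padic_of_nat flip: minus_padic.abs_eq)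

lemma cauchy_seq_of_int: "Rep_padic_cauchy_seq (of_int k) = (\<lambda>_. of_int k)"
  by (cases k rule: int_diff_cases)
     (simp add: minus_padic_cauchy_seq_rep_eq cauchy_seq_of_nat)

lemma abs_padic_const:
  "abs_padic (Abs_padic_cauchy_seq (\<lambda>_. q)) = (of_rat q :: 'p::prime_card padic)"
proof -
  obtain a b where ab: "quotient_of q = (a, b)" by fastforce
  have b: "b > 0" and q: "q = of_int a / of_int b"
    using quotient_of_denom_pos[OF ab] quotient_of_div[OF ab] by auto
  let ?Q = "Abs_padic_cauchy_seq (\<lambda>_. q) :: 'p padic_cauchy_seq"
  have "?Q * of_int b = of_int a"
    using b by (simp add: Rep_padic_cauchy_seq_inject[symmetric] times_padic_cauchy_seq.rep_eq
        cauchy_seq_of_int Abs_padic_cauchy_seq_inverse q)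
  hence "abs_padic ?Q * of_int b = of_int a"
    by (metis abs_padic_of_int times_padic.abs_eq)
  thus ?thesis using b by (simp add: q of_rat_divide field_simps)
qed

lemma padic_norm_of_rat: "\<parallel>of_rat q :: 'p::prime_card padic\<parallel>\<^sub>p = rat_padic_norm CARD('p) q"
proof -
  have "cauchy_seq_norm (Abs_padic_cauchy_seq (\<lambda>_. q) :: 'p padic_cauchy_seq) = rat_padic_norm CARD('p) q"
    using cauchy_seq_norm_tendsto[of "Abs_padic_cauchy_seq (\<lambda>_. q) :: 'p padic_cauchy_seq"]
    by (simp add: Abs_padic_cauchy_seq_inverse LIMSEQ_const_iff)
  thus ?thesis by (simp add: padic_norm_abs flip: abs_padic_const)
qed

lemma padic_of_rat_tendsto:
  fixes X :: "'p::prime_card padic_cauchy_seq"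
  shows "(\<lambda>n. of_rat (Rep_padic_cauchy_seq X n)) \<longlonglongrightarrow> abs_padic X"
proof (rule metric_LIMSEQ_I)
  fix e :: real assume e: "e > 0"
  define x where "x = Rep_padic_cauchy_seq X"
  have x: "padic_cauchy CARD('p) x" using Rep_padic_cauchy_seq[of X] by (simp add: x_def)
  obtain N where N: "\<forall>m\<ge>N. \<forall>n\<ge>N. rat_padic_norm CARD('p) (x m - x n) < e / 2"
    using x e unfolding padic_cauchy_def by (meson half_gt_zero)
  show "\<exists>N. \<forall>n\<ge>N. dist (of_rat (Rep_padic_cauchy_seq X n)) (abs_padic X) < e"
  proof (intro exI[of _ N] allI impI)
    fix n assume n: "n \<ge> N"
    let ?C = "Abs_padic_cauchy_seq (\<lambda>_. x n) :: 'p padic_cauchy_seq"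
    have "of_rat (x n) - abs_padic X = abs_padic (?C - X)"
      by (simp add: minus_padic.abs_eq flip: abs_padic_const)
    moreover have "cauchy_seq_norm (?C - X) \<le> e / 2"
    proof (rule LIMSEQ_le_const2[OF cauchy_seq_norm_tendsto])
      show "\<exists>M. \<forall>m\<ge>M. rat_padic_norm CARD('p) (Rep_padic_cauchy_seq (?C - X) m) \<le> e / 2"
        using N n by (intro exI[of _ N])
          (auto simp: minus_padic_cauchy_seq_rep_eq Abs_padic_cauchy_seq_inverse simp flip: x_def
            intro!: less_imp_le)
    qed
    ultimately show "dist (of_rat (Rep_padic_cauchy_seq X n)) (abs_padic X) < e"
      using e by (simp add: dist_padic_def padic_norm_abs flip: x_def)
  qed
qed

lemma padic_rat_dense:
  fixes x :: "'p::prime_card padic"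
  assumes "e > 0"
  shows "\<exists>q. dist (of_rat q) x < e"
proof (induction x)
  case (1 X)
  show ?case
    using metric_LIMSEQ_D[OF padic_of_rat_tendsto[of X] assms] by blast
qed

instance padic :: (prime_card) complete_space
proof
  fix X :: "nat \<Rightarrow> 'a padic" assume X: "Cauchy X"
  have "\<exists>q. dist (of_rat q) (X n) < inverse (real (Suc n))" for n
    by (rule padic_rat_dense) simp
  then obtain q where q: "\<And>n. dist (of_rat (q n)) (X n) < inverse (real (Suc n))" by metis
  have "(\<lambda>n. dist (of_rat (q n)) (X n)) \<longlonglongrightarrow> 0"
    by (rule tendsto_sandwich[OF _ _ tendsto_const LIMSEQ_inverse_real_of_nat])
       (use q in \<open>auto intro!: always_eventually less_imp_le\<close>)
  hence d: "(\<lambda>n. dist (X n) (of_rat (q n))) \<longlonglongrightarrow> 0" by (simp add: dist_commute)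
  have "padic_cauchy CARD('a) q"
    unfolding padic_cauchy_def
  proof (intro allI impI)
    fix e :: real assume e: "e > 0"
    obtain N where N: "\<And>m n. m \<ge> N \<Longrightarrow> n \<ge> N \<Longrightarrow> dist (X m) (X n) < e / 3"
      using metric_CauchyD[OF X, of "e / 3"] e by auto
    obtain M where M: "\<And>n. n \<ge> M \<Longrightarrow> dist (X n) (of_rat (q n)) < e / 3"
      using order_tendstoD(2)[OF d, of "e / 3"] e by (auto simp: eventually_sequentially)
    show "\<exists>N. \<forall>m\<ge>N. \<forall>n\<ge>N. rat_padic_norm CARD('a) (q m - q n) < e"
    proof (intro exI[of _ "max N M"] allI impI)
      fix m n assume mn: "m \<ge> max N M" "n \<ge> max N M"
      have "dist (of_rat (q m)) (of_rat (q n) :: 'a padic) < e"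
      proof (rule dist_triangle_third)
        show "dist (of_rat (q m)) (X m) < e / 3"
          using M[of m] mn dist_commute[of "X m" "of_rat (q m)"] by simp
        show "dist (X m) (X n) < e / 3" using N mn by simp
        show "dist (X n) (of_rat (q n)) < e / 3" using M mn by simp
      qed
      thus "rat_padic_norm CARD('a) (q m - q n) < e"
        by (simp add: dist_padic_def padic_norm_of_rat flip: of_rat_diff)
    qed
  qed
  hence "Rep_padic_cauchy_seq (Abs_padic_cauchy_seq q :: 'a padic_cauchy_seq) = q"
    by (simp add: Abs_padic_cauchy_seq_inverse)
  then obtain l :: "'a padic" where l: "(\<lambda>n. of_rat (q n)) \<longlonglongrightarrow> l"
    using padic_of_rat_tendsto[of "Abs_padic_cauchy_seq q :: 'a padic_cauchy_seq"] by auto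
  have "(\<lambda>n. dist (X n) (of_rat (q n)) + dist (of_rat (q n)) l) \<longlonglongrightarrow> 0"
    using tendsto_add[OF d tendsto_dist_iff[THEN iffD1, OF l]] by simp
  from tendsto_sandwich[OF _ _ tendsto_const this] have "(\<lambda>n. dist (X n) l) \<longlonglongrightarrow> 0"
    by (simp add: dist_triangle)
  hence "X \<longlonglongrightarrow> l" by (rule tendsto_dist_iff[THEN iffD2])
  thus "convergent X" by (rule convergentI)
qed


subsection \<open>\<open>p\<close>-adic integers and congruences\<close>

definition padic_ints :: "'p::prime_card padic set" (\<open>\<int>\<^sub>p\<close>) where
  "\<int>\<^sub>p = {x. \<parallel>x\<parallel>\<^sub>p \<le> 1}"

definition padic_cong :: "'p::prime_card padic \<Rightarrow> 'p padic \<Rightarrow> nat \<Rightarrow> bool" where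
  "padic_cong a b k \<longleftrightarrow> \<parallel>a - b\<parallel>\<^sub>p \<le> 1 / real CARD('p) ^ k"

definition integer_valued :: "'p::prime_card padic poly \<Rightarrow> bool" where
  "integer_valued f \<longleftrightarrow> poly f ` \<int>\<^sub>p \<subseteq> \<int>\<^sub>p"

definition compatible :: "'p::prime_card padic poly \<Rightarrow> bool" where
  "compatible f \<longleftrightarrow> (\<forall>x\<in>\<int>\<^sub>p. \<forall>y\<in>\<int>\<^sub>p. \<parallel>poly f x - poly f y\<parallel>\<^sub>p \<le> \<parallel>x - y\<parallel>\<^sub>p)"


subsection \<open>Haar measure and ergodicity\<close>

text \<open>
  The normalized Haar measure of the compact group \<open>\<int>\<^sub>p\<close> is the unique translation-invariant
  Borel probability measure on it.
\<close>

definition normalized_haar :: "'p::prime_card padic measure \<Rightarrow> bool" where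
  "normalized_haar \<mu> \<longleftrightarrow>
     sets \<mu> = sets (restrict_space borel \<int>\<^sub>p) \<and>
     emeasure \<mu> \<int>\<^sub>p = 1 \<and>
     (\<forall>a\<in>\<int>\<^sub>p. \<forall>A\<in>sets \<mu>. emeasure \<mu> ((+) a ` A) = emeasure \<mu> A)"

definition measure_preserving_map :: "'a measure \<Rightarrow> ('a \<Rightarrow> 'a) \<Rightarrow> bool" where
  "measure_preserving_map M T \<longleftrightarrow>
     T \<in> measurable M M \<and> (\<forall>A\<in>sets M. emeasure M (T -` A \<inter> space M) = emeasure M A)"

definition ergodic_map :: "'a measure \<Rightarrow> ('a \<Rightarrow> 'a) \<Rightarrow> bool" where
  "ergodic_map M T \<longleftrightarrow>
     measure_preserving_map M T \<and>
     (\<forall>A\<in>sets M. T -` A \<inter> space M = A \<longrightarrow> emeasure M A = 0 \<or> emeasure M (space M - A) = 0)"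

end

theory Submission
  imports Defs
begin

text \<open>
  Put \<open>P\<^sub>k = c\<^sub>k + \<Sum>i\<le>r. d\<^sub>k\<^sub>i f\<^sup>i\<close>, where \<open>f\<^sup>i\<close> is the iterate under composition. By hypothesis
  \<open>P\<^sub>k \<longlonglongrightarrow> 0\<close> at every point of the orbit. If the orbit is infinite, Lagrange interpolation at
  sufficiently many of its points shows that all coefficients of \<open>P\<^sub>k\<close> tend to \<open>0\<close>; as
  \<open>1, f\<^sup>0, f\<^sup>1, \<dots>\<close> have strictly increasing degrees, so do \<open>c\<^sub>k\<close> and the \<open>d\<^sub>k\<^sub>i\<close>.

  The orbit is infinite: compatibility makes every closed neighbourhood of a finite orbit forward
  invariant, so by ergodicity it has full measure, because balls are not null. Shrinking the
  neighbourhoods, the finite orbit itself would have full measure, but points are null.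
\<close>

section \<open>Null sequences of \<open>p\<close>-adic numbers\<close>

text \<open>Reduces \<open>p\<close>-adic null sequences to real ones, so that real limit laws give
  those for sums and multiples.\<close>

lemma padic_tendsto_0_iff:
  fixes X :: "nat \<Rightarrow> 'p::prime_card padic"
  shows "X \<longlonglongrightarrow> 0 \<longleftrightarrow> (\<lambda>k. \<parallel>X k\<parallel>\<^sub>p) \<longlonglongrightarrow> 0"
  by (subst tendsto_dist_iff) (simp add: dist_padic_def)

lemma padic_norm_triangle: "\<parallel>x + y\<parallel>\<^sub>p \<le> \<parallel>x\<parallel>\<^sub>p + \<parallel>y\<parallel>\<^sub>p"
  using padic_norm_ultrametric[of x y] padic_norm_nonneg[of x] padic_norm_nonneg[of y]
  by linarith

lemma padic_null_add:
  fixes X Y :: "nat \<Rightarrow> 'p::prime_card padic"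
  assumes "X \<longlonglongrightarrow> 0" "Y \<longlonglongrightarrow> 0"
  shows "(\<lambda>k. X k + Y k) \<longlonglongrightarrow> 0"
  unfolding padic_tendsto_0_iff
proof (rule tendsto_sandwich[OF _ _ tendsto_const])
  show "(\<lambda>k. \<parallel>X k\<parallel>\<^sub>p + \<parallel>Y k\<parallel>\<^sub>p) \<longlonglongrightarrow> 0"
    using tendsto_add[OF assms[unfolded padic_tendsto_0_iff]] by simp
qed (simp_all add: padic_norm_triangle)

lemma padic_null_mult_right:
  fixes X :: "nat \<Rightarrow> 'p::prime_card padic"
  assumes "X \<longlonglongrightarrow> 0"
  shows "(\<lambda>k. X k * a) \<longlonglongrightarrow> 0"
  using tendsto_mult_right[OF assms[unfolded padic_tendsto_0_iff], of "\<parallel>a\<parallel>\<^sub>p"]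
  by (simp add: padic_tendsto_0_iff padic_norm_mult mult.commute)

lemma padic_null_diff:
  fixes X Y :: "nat \<Rightarrow> 'p::prime_card padic"
  assumes "X \<longlonglongrightarrow> 0" "Y \<longlonglongrightarrow> 0"
  shows "(\<lambda>k. X k - Y k) \<longlonglongrightarrow> 0"
  using padic_null_add[OF assms(1) padic_null_mult_right[OF assms(2), of "-1"]] by simp

lemma padic_null_sum:
  fixes X :: "nat \<Rightarrow> 'i \<Rightarrow> 'p::prime_card padic"
  assumes "\<And>i. i \<in> I \<Longrightarrow> (\<lambda>k. X k i) \<longlonglongrightarrow> 0"
  shows "(\<lambda>k. \<Sum>i\<in>I. X k i) \<longlonglongrightarrow> 0"
  using assms by (induction I rule: infinite_finite_induct) (auto intro: padic_null_add)

section \<open>Pointwise null sequences of polynomials\<close>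

text \<open>The basis \<open>L\<close> is fixed before \<open>P\<close> is chosen, so one
  \<open>L\<close> serves a whole sequence of polynomials; the limit argument relies on this
  uniformity.\<close>

lemma lagrange_interpolation:
  fixes S :: "'a::field set"
  assumes "finite S"
  obtains L where "\<And>P. degree P < card S \<Longrightarrow> P = (\<Sum>s\<in>S. Polynomial.smult (poly P s) (L s))"
proof
  define L where
    "L s = Polynomial.smult (inverse (\<Prod>t\<in>S-{s}. s - t)) (\<Prod>t\<in>S-{s}. [:-t, 1:])" for s
  have L: "poly (L s) u = (if u = s then 1 else 0)" if "s \<in> S" "u \<in> S" for s u
    using that assms by (auto simp: L_def poly_prod)
  have deg: "degree (L s) < card S" if "s \<in> S" for s
  proof -
    have "degree (L s) \<le> (\<Sum>t\<in>S-{s}. degree [:-t, 1:])"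
      unfolding L_def
      by (rule order.trans[OF Polynomial.degree_smult_le])
         (use degree_prod_sum_le[of "S - {s}" "\<lambda>t. [:-t, 1:]"] assms in \<open>simp add: o_def\<close>)
    also have "\<dots> = card (S - {s})" by simp
    also have "\<dots> < card S" using that assms by (rule card_Diff1_less[rotated])
    finally show ?thesis .
  qed
  show "P = (\<Sum>s\<in>S. Polynomial.smult (poly P s) (L s))" (is "_ = ?Q") if P: "degree P < card S" for P
  proof (rule ccontr)
    assume neq: "P \<noteq> ?Q"
    \<comment> \<open>\<open>P - ?Q\<close> has degree below \<open>card S\<close> but vanishes on
      all of \<open>S\<close>: too many roots.\<close>
    have "degree ?Q < card S"
      using deg P by (intro degree_sum_less) (auto intro: order.strict_trans1[OF degree_smult_le])
    hence "degree (P - ?Q) < card S" using P by (intro degree_diff_less)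
    moreover have "poly (P - ?Q) u = 0" if "u \<in> S" for u
      using that assms by (simp add: poly_sum L if_distrib[of "(*) _"] cong: if_cong)
    hence "card S \<le> card {u. poly (P - ?Q) u = 0}"
      using neq by (intro card_mono poly_roots_finite) auto
    moreover have "\<dots> \<le> degree (P - ?Q)"
      using neq by (intro card_poly_roots_bound) auto
    ultimately show False by linarith
  qed
qed

text \<open>With \<open>N + 1\<close> fixed nodes, each coefficient of \<open>P k\<close> is a
  linear combination of the values of \<open>P k\<close> there, with weights independent of
  \<open>k\<close>.\<close>

lemma coeff_null_of_pointwise_null:
  fixes P :: "nat \<Rightarrow> 'p::prime_card padic poly"
  assumes "infinite S" and deg: "\<And>k. degree (P k) \<le> N"
    and null: "\<And>s. s \<in> S \<Longrightarrow> (\<lambda>k. poly (P k) s) \<longlonglongrightarrow> 0"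
  shows "(\<lambda>k. Polynomial.coeff (P k) m) \<longlonglongrightarrow> 0"
proof -
  obtain T where T: "T \<subseteq> S" "finite T" "card T = Suc N"
    using infinite_arbitrarily_large[OF assms(1), of "Suc N"] by blast
  obtain L where "\<And>P. degree P < card T \<Longrightarrow> P = (\<Sum>s\<in>T. Polynomial.smult (poly P s) (L s))"
    using lagrange_interpolation[OF T(2)] by blast
  hence "P k = (\<Sum>s\<in>T. Polynomial.smult (poly (P k) s) (L s))" for k
    using deg[of k] T(3) by simp
  hence "Polynomial.coeff (P k) m = (\<Sum>s\<in>T. poly (P k) s * Polynomial.coeff (L s) m)" for k
    by (metis (no_types, lifting) coeff_smult coeff_sum sum.cong)
  moreover have "(\<lambda>k. \<Sum>s\<in>T. poly (P k) s * Polynomial.coeff (L s) m) \<longlonglongrightarrow> 0"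
    using null T(1) by (intro padic_null_sum padic_null_mult_right) auto
  ultimately show ?thesis by simp
qed

text \<open>Induction on \<open>n\<close>, peeling off the summand of largest degree, whose scalar
  can be read off a single coefficient.\<close>

lemma combination_null_imp_coeffs_null:
  fixes G :: "nat \<Rightarrow> 'p::prime_card padic poly"
  assumes "infinite S" and deg: "strict_mono (\<lambda>i. degree (G i))" and nz: "\<And>i. G i \<noteq> 0"
  shows "(\<And>s. s \<in> S \<Longrightarrow> (\<lambda>k. \<Sum>i<n. a k i * poly (G i) s) \<longlonglongrightarrow> 0)
    \<Longrightarrow> i < n \<Longrightarrow> (\<lambda>k. a k i) \<longlonglongrightarrow> 0"
proof (induction n)
  case (Suc n)
  define P where "P k = (\<Sum>i<Suc n. Polynomial.smult (a k i) (G i))" for k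
  have less: "degree (G i) < degree (G n)" if "i < n" for i
    using strict_monoD[OF deg that] .
  have "degree (Polynomial.smult (a k i) (G i)) \<le> degree (G n)" if "i < Suc n" for k i
    using less[of i] that degree_smult_le[of "a k i" "G i"] by (cases "i = n") auto
  hence "degree (P k) \<le> degree (G n)" for k
    unfolding P_def by (intro degree_sum_le) auto
  moreover have "(\<lambda>k. poly (P k) s) \<longlonglongrightarrow> 0" if "s \<in> S" for s
    using Suc.prems(1)[OF that] by (simp add: P_def poly_sum)
  ultimately have "(\<lambda>k. Polynomial.coeff (P k) (degree (G n))) \<longlonglongrightarrow> 0"
    using coeff_null_of_pointwise_null[OF assms(1)] by blast
  \<comment> \<open>Each \<open>G i\<close> with \<open>i < n\<close> has smaller degree, so only
    the last summand reaches this coefficient.\<close>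
  moreover have "Polynomial.coeff (P k) (degree (G n)) = a k n * lead_coeff (G n)" for k
    using less by (simp add: P_def coeff_sum coeff_eq_0)
  ultimately have "(\<lambda>k. a k n * lead_coeff (G n)) \<longlonglongrightarrow> 0" by simp
  from padic_null_mult_right[OF this, of "inverse (lead_coeff (G n))"]
  have "(\<lambda>k. a k n * lead_coeff (G n) * inverse (lead_coeff (G n))) \<longlonglongrightarrow> 0" .
  moreover have "a k n * lead_coeff (G n) * inverse (lead_coeff (G n)) = a k n" for k
    using nz[of n] by simp
  ultimately have top: "(\<lambda>k. a k n) \<longlonglongrightarrow> 0" by simp
  \<comment> \<open>Subtracting the null top term leaves the premise of the induction
    hypothesis.\<close>
  have "(\<lambda>k. \<Sum>i<n. a k i * poly (G i) s) \<longlonglongrightarrow> 0" if "s \<in> S" for s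
    using padic_null_diff[OF Suc.prems(1)[OF that] padic_null_mult_right[OF top, of "poly (G n) s"]]
    by simp
  from Suc.IH[OF this] top Suc.prems(2) show ?case by (cases "i = n") auto
qed simp

section \<open>Infinite orbits of ergodic maps\<close>

text \<open>Ergodicity speaks of sets equal to their preimage. Forward invariance makes the iterated
  preimages of \<open>A\<close> increase, all with the measure of \<open>A\<close>; their union
  equals its own preimage and still has that measure.\<close>

lemma ergodic_map_forward_invariant:
  assumes erg: "ergodic_map M T" and "finite_measure M"
    and A: "A \<in> sets M" and inv: "T ` A \<subseteq> A"
  shows "emeasure M A = 0 \<or> emeasure M (space M - A) = 0"
proof -
  interpret finite_measure M by fact
  have T: "T \<in> measurable M M"
    and pres: "\<And>S. S \<in> sets M \<Longrightarrow> emeasure M (T -` S \<inter> space M) = emeasure M S"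
    using erg by (auto simp: ergodic_map_def measure_preserving_map_def)
  define P where "P n = ((\<lambda>S. T -` S \<inter> space M) ^^ n) A" for n
  have Suc: "P (Suc n) = T -` P n \<inter> space M" for n by (simp add: P_def)
  have P0: "P 0 = A" by (simp add: P_def)
  have sets: "P n \<in> sets M" for n
    by (induction n) (use A T in \<open>auto simp: P0 Suc\<close>)
  have meas: "emeasure M (P n) = emeasure M A" for n
    by (induction n) (use sets pres in \<open>auto simp: P0 Suc\<close>)
  have sub: "P n \<subseteq> P (Suc n)" for n
  proof (induction n)
    case 0
    show ?case using inv sets.sets_into_space[OF A] by (auto simp: P0 Suc)
  qed (auto simp: Suc)
  define B where "B = (\<Union>n. P n)"
  have B: "B \<in> sets M" using sets by (auto simp: B_def)
  have "(\<lambda>n. emeasure M (P n)) \<longlonglongrightarrow> emeasure M B"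
    unfolding B_def using sets sub by (intro Lim_emeasure_incseq incseq_SucI) auto
  hence eq: "emeasure M B = emeasure M A" by (simp add: meas LIMSEQ_const_iff)
  \<comment> \<open>Taking preimages shifts the increasing family by one index, which leaves the
    union unchanged.\<close>
  have "T -` B \<inter> space M = (\<Union>n. P (Suc n))" by (auto simp: B_def Suc)
  also have "\<dots> = B" using sub by (auto simp: B_def)
  finally have "emeasure M B = 0 \<or> emeasure M (space M - B) = 0"
    using erg B by (auto simp: ergodic_map_def)
  moreover have "emeasure M (space M - B) = emeasure M (space M - A)"
    using A B by (simp add: emeasure_compl eq)
  ultimately show ?thesis by (simp add: eq)
qed

section \<open>The normalized Haar measure: points are null, balls are not\<close>

lemma padic_ints_eq_cball: "\<int>\<^sub>p = cball 0 1"
  by (auto simp: padic_ints_def dist_padic_def)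

lemma padic_ints_add: "x \<in> \<int>\<^sub>p \<Longrightarrow> y \<in> \<int>\<^sub>p \<Longrightarrow> x + y \<in> \<int>\<^sub>p"
  using padic_norm_ultrametric[of x y] by (auto simp: padic_ints_def)

lemma padic_ints_of_nat: "(of_nat n :: 'p::prime_card padic) \<in> \<int>\<^sub>p"
proof (induction n)
  case (Suc n)
  thus ?case using padic_ints_add[of 1 "of_nat n"] by (simp add: padic_ints_def)
qed (simp add: padic_ints_eq_cball)

context
  fixes \<mu> :: "'p::prime_card padic measure"
  assumes haar: "normalized_haar \<mu>"
begin

lemma normalized_haar_space: "space \<mu> = \<int>\<^sub>p"
proof -
  have "space \<mu> = space (restrict_space borel \<int>\<^sub>p)"
    using haar by (intro sets_eq_imp_space_eq) (simp add: normalized_haar_def)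
  thus ?thesis by (simp add: space_restrict_space)
qed

lemma normalized_haar_finite_measure: "finite_measure \<mu>"
  using haar by (intro finite_measureI) (simp add: normalized_haar_space normalized_haar_def)

lemma normalized_haar_sets_closed:
  assumes "closed A" "A \<subseteq> \<int>\<^sub>p"
  shows "A \<in> sets \<mu>"
proof -
  have "A \<in> sets (restrict_space borel \<int>\<^sub>p)"
    using assms by (subst sets_restrict_space_iff) (auto simp: padic_ints_eq_cball)
  thus ?thesis using haar by (simp add: normalized_haar_def)
qed

lemma normalized_haar_translate:
  "a \<in> \<int>\<^sub>p \<Longrightarrow> A \<in> sets \<mu> \<Longrightarrow> emeasure \<mu> ((+) a ` A) = emeasure \<mu> A"
  using haar by (simp add: normalized_haar_def)

text \<open>Translation invariance gives all points the same mass, and infinitely many of them share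
  a finite total.\<close>

lemma normalized_haar_singleton:
  assumes "a \<in> \<int>\<^sub>p"
  shows "emeasure \<mu> {a} = 0"
proof -
  interpret finite_measure \<mu> by (rule normalized_haar_finite_measure)
  have 0: "0 \<in> \<int>\<^sub>p" using padic_ints_of_nat[of 0] by simp
  have pt: "{b} \<in> sets \<mu>" if "b \<in> \<int>\<^sub>p" for b
    using that by (intro normalized_haar_sets_closed) auto
  have eq: "emeasure \<mu> {b} = emeasure \<mu> {0}" if "b \<in> \<int>\<^sub>p" for b
    using normalized_haar_translate[OF that pt[OF 0]] by simp
  have bound: "real n * measure \<mu> {0} \<le> measure \<mu> (space \<mu>)" for n
  proof -
    \<comment> \<open>In characteristic 0 the first \<open>n\<close> naturals are \<open>n\<close>
      distinct points of \<open>\<int>\<^sub>p\<close>.\<close>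
    have "measure \<mu> (of_nat ` {..<n}) = (\<Sum>b\<in>of_nat ` {..<n}. measure \<mu> {b})"
      using pt padic_ints_of_nat by (intro finite_measure_eq_sum_singleton) auto
    also have "\<dots> = (\<Sum>b\<in>(of_nat ` {..<n} :: 'p padic set). measure \<mu> {0})"
      using eq padic_ints_of_nat[where 'p = 'p] by (intro sum.cong) (auto simp: measure_def)
    also have "\<dots> = real n * measure \<mu> {0}"
      by (simp add: card_image)
    finally show ?thesis using bounded_measure[of "of_nat ` {..<n}"] by simp
  qed
  have "measure \<mu> {0} = 0"
  proof (rule ccontr)
    assume "measure \<mu> {0} \<noteq> 0"
    hence "measure \<mu> {0} > 0" by (simp add: zero_less_measure_iff)
    then obtain n where "real n * measure \<mu> {0} > measure \<mu> (space \<mu>)"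
      using reals_Archimedean3 by blast
    thus False using bound[of n] by simp
  qed
  thus ?thesis using eq[OF assms] by (simp add: emeasure_eq_measure)
qed

text \<open>Countably many translates of the ball cover \<open>\<int>\<^sub>p\<close>, so a null
  ball would make the whole space null.\<close>

lemma normalized_haar_cball_nonzero:
  assumes "a \<in> \<int>\<^sub>p" "e > 0"
  shows "emeasure \<mu> (cball a e \<inter> \<int>\<^sub>p) \<noteq> 0"
proof
  assume null: "emeasure \<mu> (cball a e \<inter> \<int>\<^sub>p) = 0"
  \<comment> \<open>The centres: countable, so that the union stays null, and dense, so that the
    balls cover.\<close>
  define Q where "Q = range of_rat \<inter> (\<int>\<^sub>p :: 'p padic set)"
  define U where "U b = (+) (b - a) ` (cball a e \<inter> \<int>\<^sub>p)" for b
  \<comment> \<open>Both \<open>b - a\<close> and \<open>a - b\<close> lie in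
    \<open>\<int>\<^sub>p\<close>, so the translation maps \<open>\<int>\<^sub>p\<close> onto itself
    and carries the ball around \<open>a\<close> to the one around \<open>b\<close>.\<close>
  have U: "U b = cball b e \<inter> \<int>\<^sub>p" if b: "b \<in> \<int>\<^sub>p" for b
  proof -
    have "- a \<in> \<int>\<^sub>p" "- b \<in> \<int>\<^sub>p" using assms(1) b by (auto simp: padic_ints_def)
    hence ba: "b - a \<in> \<int>\<^sub>p" "a - b \<in> \<int>\<^sub>p"
      using padic_ints_add[OF b, of "- a"] padic_ints_add[OF assms(1), of "- b"] by auto
    show ?thesis
    proof (intro equalityI subsetI)
      fix y assume "y \<in> cball b e \<inter> \<int>\<^sub>p"
      hence "y + (a - b) \<in> cball a e \<inter> \<int>\<^sub>p"
        using padic_ints_add[OF _ ba(2)] by (auto simp: dist_padic_def)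
      moreover have "y = (b - a) + (y + (a - b))" by simp
      ultimately show "y \<in> U b" unfolding U_def by blast
    next
      fix y assume "y \<in> U b"
      then obtain z where z: "y = (b - a) + z" "z \<in> cball a e" "z \<in> \<int>\<^sub>p" by (auto simp: U_def)
      have "b - y = a - z" using z(1) by simp
      thus "y \<in> cball b e \<inter> \<int>\<^sub>p"
        using padic_ints_add[OF ba(1) z(3)] z by (simp add: dist_padic_def)
    qed
  qed
  have closed: "cball b e \<inter> \<int>\<^sub>p \<in> sets \<mu>" for b
    by (intro normalized_haar_sets_closed) (auto simp: padic_ints_eq_cball)
  have "U b \<in> null_sets \<mu>" if b: "b \<in> \<int>\<^sub>p" for b
  proof -
    have "b - a \<in> \<int>\<^sub>p"
      using padic_ints_add[OF b, of "- a"] assms(1) by (simp add: padic_ints_def)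
    hence "emeasure \<mu> (U b) = 0"
      unfolding U_def using closed null by (simp add: normalized_haar_translate)
    thus ?thesis using closed U[OF b] by (simp add: null_sets_def)
  qed
  hence "(\<Union>b\<in>Q. U b) \<in> null_sets \<mu>"
    by (intro null_sets_UN') (auto simp: Q_def)
  moreover have "\<int>\<^sub>p \<subseteq> (\<Union>b\<in>Q. U b)"
  proof
    fix y :: "'p padic" assume y: "y \<in> \<int>\<^sub>p"
    \<comment> \<open>Distance below \<open>e\<close> puts \<open>y\<close> into the ball around
      \<open>of_rat q\<close>; distance below 1 makes \<open>of_rat q\<close> a
      \<open>p\<close>-adic integer.\<close>
    obtain q where q: "dist (of_rat q) y < min e 1"
      using padic_rat_dense[of "min e 1" y] assms(2) by auto
    hence "of_rat q - y \<in> \<int>\<^sub>p" by (simp add: dist_padic_def padic_ints_def)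
    from padic_ints_add[OF this y] have "of_rat q \<in> Q" by (simp add: Q_def)
    moreover from this have "y \<in> U (of_rat q)" using q y by (simp add: U Q_def)
    ultimately show "y \<in> (\<Union>b\<in>Q. U b)" by blast
  qed
  ultimately have "\<int>\<^sub>p \<in> null_sets \<mu>"
    using null_sets_subset[of "\<Union>b\<in>Q. U b" \<mu> "\<int>\<^sub>p"] normalized_haar_space sets.top[of \<mu>] by simp
  thus False using haar by (simp add: normalized_haar_def null_sets_def)
qed

lemma ergodic_orbit_infinite:
  assumes lip: "\<And>y z. y \<in> \<int>\<^sub>p \<Longrightarrow> z \<in> \<int>\<^sub>p \<Longrightarrow> dist (T y) (T z) \<le> dist y z"
    and into: "T ` \<int>\<^sub>p \<subseteq> \<int>\<^sub>p" and erg: "ergodic_map \<mu> T"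
    and x0: "x 0 \<in> \<int>\<^sub>p" and step: "\<And>n. x (Suc n) = T (x n)"
  shows "infinite (range x)"
proof
  assume fin: "finite (range x)"
  have x: "x n \<in> \<int>\<^sub>p" for n
    by (induction n) (use x0 step into in auto)
  \<comment> \<open>The \<open>e\<close>-neighbourhood of the orbit within
    \<open>\<int>\<^sub>p\<close>; as a finite union of closed sets it is measurable.\<close>
  define A where "A e = (\<Union>a\<in>range x. cball a e \<inter> \<int>\<^sub>p)" for e
  have A: "A e \<in> sets \<mu>" for e
    unfolding A_def using fin
    by (intro normalized_haar_sets_closed closed_UN) (auto simp: padic_ints_eq_cball)
  have full: "\<int>\<^sub>p - A e \<in> null_sets \<mu>" if e: "e > 0" for e
  proof -
    have "T ` A e \<subseteq> A e"
    proof
      fix z assume "z \<in> T ` A e"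
      then obtain y n where y: "z = T y" "y \<in> \<int>\<^sub>p" "dist (x n) y \<le> e" by (auto simp: A_def)
      \<comment> \<open>\<open>T\<close> is 1-Lipschitz, so the ball around \<open>x n\<close> lands
        in the ball of the same radius around \<open>x (Suc n)\<close>.\<close>
      hence "dist (x (Suc n)) z \<le> e" using lip[OF x y(2), of n] step[of n] by simp
      thus "z \<in> A e" using y into by (auto simp: A_def)
    qed
    hence "emeasure \<mu> (A e) = 0 \<or> emeasure \<mu> (space \<mu> - A e) = 0"
      by (intro ergodic_map_forward_invariant[OF erg normalized_haar_finite_measure A])
    moreover have "emeasure \<mu> (cball (x 0) e \<inter> \<int>\<^sub>p) \<le> emeasure \<mu> (A e)"
      using A by (intro emeasure_mono) (auto simp: A_def)
    hence "emeasure \<mu> (A e) \<noteq> 0"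
      using normalized_haar_cball_nonzero[OF x0 e] by auto
    ultimately show ?thesis
      using A[of e] sets.compl_sets[OF A[of e]] by (auto simp: null_sets_def normalized_haar_space)
  qed
  have "(\<Union>n. \<int>\<^sub>p - A (inverse (real (Suc n)))) \<in> null_sets \<mu>"
    by (intro null_sets_UN full) auto
  moreover have "(\<Union>a\<in>range x. {a}) \<in> null_sets \<mu>"
    using x fin normalized_haar_singleton
    by (intro null_sets_UN') (auto simp: null_sets_def intro!: normalized_haar_sets_closed countable_finite)
  ultimately have "(\<Union>n. \<int>\<^sub>p - A (inverse (real (Suc n)))) \<union> (\<Union>a\<in>range x. {a}) \<in> null_sets \<mu>"
    by (rule null_sets.Un)
  moreover have "\<int>\<^sub>p \<subseteq> (\<Union>n. \<int>\<^sub>p - A (inverse (real (Suc n)))) \<union> (\<Union>a\<in>range x. {a})"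
  proof
    fix y :: "'p padic" assume y: "y \<in> \<int>\<^sub>p"
    show "y \<in> (\<Union>n. \<int>\<^sub>p - A (inverse (real (Suc n)))) \<union> (\<Union>a\<in>range x. {a})"
    proof (cases "y \<in> range x")
      case False
      \<comment> \<open>A point off the finite orbit has positive distance from it and leaves the
        neighbourhood once the radius drops below that distance.\<close>
      obtain e where e: "e > 0" "\<And>a. a \<in> range x \<Longrightarrow> a \<noteq> y \<Longrightarrow> e \<le> dist y a"
        using finite_set_avoid[OF fin, of y] by blast
      obtain n where "inverse (real (Suc n)) < e" using reals_Archimedean[OF e(1)] by blast
      hence "inverse (real (Suc n)) < dist a y" if "a \<in> range x" for a
        using e(2)[OF that] that False by (metis dist_commute order.strict_trans2)
      hence "y \<notin> A (inverse (real (Suc n)))" by (auto simp: A_def not_le)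
      thus ?thesis using y by blast
    qed auto
  qed
  ultimately have "\<int>\<^sub>p \<in> null_sets \<mu>"
    by (metis normalized_haar_space null_sets_subset sets.top)
  thus False using haar by (simp add: normalized_haar_def null_sets_def)
qed

end

section \<open>Linear congruences along the orbit\<close>

theorem theorem5p3:
  fixes f :: "'p::prime_card padic poly"
    and \<mu> :: "'p padic measure"
    and x :: "nat \<Rightarrow> 'p padic"
    and r :: nat
    and c :: "nat \<Rightarrow> 'p padic"
    and d :: "nat \<Rightarrow> nat \<Rightarrow> 'p padic"
  assumes "integer_valued f"
    and "compatible f"
    and "normalized_haar \<mu>"
    and "ergodic_map \<mu> (poly f)"
    and "degree f > 1"
    and "x 0 \<in> \<int>\<^sub>p"
    and "\<And>n. x (Suc n) = poly f (x n)"
    and "\<And>k. c k \<in> \<int>\<^sub>p"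
    and "\<And>k i. i \<le> r \<Longrightarrow> d k i \<in> \<int>\<^sub>p"
    and "\<And>k n. padic_cong (c k + (\<Sum>i=0..r. d k i * x (n + i))) 0 k"
  shows "c \<longlonglongrightarrow> 0 \<and> (\<forall>i\<le>r. (\<lambda>k. d k i) \<longlonglongrightarrow> 0)"
proof -
  have inf: "infinite (range x)"
    using assms(1,2,6,7)
    by (intro ergodic_orbit_infinite[OF assms(3) _ _ assms(4)])
       (auto simp: integer_valued_def compatible_def dist_padic_def)
  \<comment> \<open>Polynomials that express \<open>x (n + i)\<close> through
    \<open>x n\<close>.\<close>
  define F where "F i = ((\<lambda>g. pcompose f g) ^^ i) [:0, 1:]" for i
  have F_Suc: "F (Suc i) = pcompose f (F i)" for i by (simp add: F_def)
  have deg_F: "degree (F i) = degree f ^ i" for i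
    by (induction i) (auto simp: F_Suc degree_pcompose, simp add: F_def)
  have poly_F: "poly (F i) (x n) = x (n + i)" for i n
    by (induction i) (auto simp: F_Suc poly_pcompose assms(7), simp add: F_def)
  \<comment> \<open>Index shift: the constant \<open>1\<close> takes index 0 and pairs with
    \<open>c k\<close>, while \<open>F j\<close> and \<open>d k j\<close> move to
    \<open>Suc j\<close>, giving \<open>r + 2\<close> terms.\<close>
  define G where "G i = (case i of 0 \<Rightarrow> 1 | Suc j \<Rightarrow> F j)" for i
  define a where "a k i = (case i of 0 \<Rightarrow> c k | Suc j \<Rightarrow> d k j)" for k i
  \<comment> \<open>The first step goes from the constant to the identity, of degree 1; every later
    one multiplies the degree by \<open>degree f > 1\<close>.\<close>
  have "degree (G i) < degree (G (Suc i))" for i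
    using assms(5) by (cases i) (auto simp: G_def deg_F)
  hence mono: "strict_mono (\<lambda>i. degree (G i))" by (simp add: strict_mono_Suc_iff)
  have nz: "G i \<noteq> 0" for i
  proof (cases i)
    case (Suc j)
    have "degree (G i) > 0" using assms(5) by (simp add: Suc G_def deg_F)
    thus ?thesis by auto
  qed (simp add: G_def)
  \<comment> \<open>At an orbit point the combination is the left side of the congruence, of norm at
    most \<open>1 / p^k\<close>.\<close>
  have null: "(\<lambda>k. \<Sum>i<Suc (Suc r). a k i * poly (G i) s) \<longlonglongrightarrow> 0" if "s \<in> range x" for s
  proof -
    from that obtain n where n: "s = x n" by auto
    have "(\<Sum>i<Suc (Suc r). a k i * poly (G i) s) = c k + (\<Sum>i=0..r. d k i * x (n + i))" for k
      unfolding sum.lessThan_Suc_shift[of _ "Suc r"]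
      by (simp add: a_def G_def n poly_F atLeast0AtMost lessThan_Suc_atMost del: sum.lessThan_Suc)
    moreover have "(\<lambda>k. c k + (\<Sum>i=0..r. d k i * x (n + i))) \<longlonglongrightarrow> 0"
      unfolding padic_tendsto_0_iff
    proof (rule tendsto_sandwich[OF _ _ tendsto_const])
      have "real CARD('p) > 1" using prime_gt_1_nat[OF prime_card[where 'a = 'p]] by simp
      thus "(\<lambda>k. 1 / real CARD('p) ^ k) \<longlonglongrightarrow> 0"
        using LIMSEQ_inverse_realpow_zero[of "real CARD('p)"] by (simp add: inverse_eq_divide)
      show "\<forall>\<^sub>F k in sequentially. \<parallel>c k + (\<Sum>i=0..r. d k i * x (n + i))\<parallel>\<^sub>p \<le> 1 / real CARD('p) ^ k"
        using assms(10) by (simp add: padic_cong_def)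
    qed simp
    ultimately show ?thesis by simp
  qed
  have lim: "(\<lambda>k. a k i) \<longlonglongrightarrow> 0" if "i < Suc (Suc r)" for i
    using combination_null_imp_coeffs_null[OF inf mono nz null that] .
  show ?thesis using lim[of 0] lim[of "Suc _"] by (auto simp: a_def)
qed

end
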